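(* Let $n\ge 1$, $\mathcal{N}=\{1,\ldots,n\}$, let $\mathcal{C}\subset\mathbb{R}^n$ be a nonempty set, let $f:\mathbb{R}\to\mathbb{R}$ be a convex function, and let $a\in\mathbb{R}^n_{>0}$ and $b\in\mathbb{R}^n$. Suppose that $\mathcal{C}$ satisfies the following condition: for all convex functions $\phi_i:\mathbb{R}\to\mathbb{R}$ ($i\in\mathcal{N}$), a point $x\in\mathcal{C}$ minimizes $\sum_{i\in\mathcal{N}}\phi_i(x_i)$ over $\mathcal{C}$ if and only if $\phi_k^{+}(x_k)\ge\phi_i^{-}(x_i)$ for every exchangeable pair $(i,k)\in\mathcal{E}_{\mathcal{C}}(x)$. If $x\in\mathcal{C}$ is an optimal solution to $$\min_{x\in\mathcal{C}}\ \sum_{i\in\mathcal{N}} a_i\cdot\frac12\left(\frac{x_i}{a_i}+b_i\right)^2,$$ then $x$ is also an optimal solution to $$\min_{x\in\mathcal{C}}\ \sum_{i\in\mathcal{N}} a_i f\left(\frac{x_i}{a_i}+b_i\right).$$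
   Context: For a convex function $\phi:\mathbb{R}\to\mathbb{R}$, $\phi^{-}$ and $\phi^{+}$ denote its left and right derivatives. $e^i\in\mathbb{R}^n$ is the $i$-th standard basis vector. For $\mathcal{C}\subset\mathbb{R}^n$ and $x\in\mathcal{C}$, the set of exchangeable pairs is $$\mathcal{E}_{\mathcal{C}}(x):=\{(i,k)\in\mathcal{N}^2\ |\ x+\epsilon(e^k-e^i)\in\mathcal{C}\text{ for some }\epsilon>0\}.$$ No property of $\mathcal{C}$ other than nonemptiness and the stated condition is assumed, and $f$ is not assumed strictly convex or differentiable. *)

theory Defs
  imports "HOL-Analysis.Analysis"
begin

(* The limits below exist for every convex function on the reals; where a one-sided
   derivative does not exist, the value is unspecified. *)

definition left_deriv :: "(real \<Rightarrow> real) \<Rightarrow> real \<Rightarrow> real" where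
  "left_deriv \<phi> x = Lim (at_left x) (\<lambda>y. (\<phi> y - \<phi> x) / (y - x))"

definition right_deriv :: "(real \<Rightarrow> real) \<Rightarrow> real \<Rightarrow> real" where
  "right_deriv \<phi> x = Lim (at_right x) (\<lambda>y. (\<phi> y - \<phi> x) / (y - x))"

definition exchangeable_pairs :: "(real ^ 'n) set \<Rightarrow> real ^ 'n \<Rightarrow> ('n \<times> 'n) set" where
  "exchangeable_pairs C x = {(i, k). \<exists>\<epsilon>>0. x + \<epsilon> *\<^sub>R (axis k 1 - axis i 1) \<in> C}"

end

theory Submission
  imports Defs
begin

text \<open>For the quadratic objective the exchange condition says that \<open>u\<^sub>i \<le> u\<^sub>k\<close> for every exchangeable
  pair, where \<open>u\<^sub>i = x\<^sub>i / a\<^sub>i + b\<^sub>i\<close>. Since the one-sided difference quotients of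
  \<open>t \<mapsto> a\<^sub>i f (t / a\<^sub>i + b\<^sub>i)\<close> at \<open>x\<^sub>i\<close> are those of \<open>f\<close> at \<open>u\<^sub>i\<close>, convexity of \<open>f\<close> turns this
  ordering into the exchange condition for \<open>f\<close>.\<close>

text \<open>The infimum bounds every value from below, while a single \<open>z\<close> with
  \<open>g z < c\<close> controls, by monotonicity, all points between \<open>x\<close> and
  \<open>z\<close>. This and its mirror image supply the existence of the limits behind the
  one-sided derivatives.\<close>

lemma mono_on_tendsto_at_right:
  fixes g :: "real \<Rightarrow> real"
  assumes mono: "mono_on {x<..} g" and bdd: "bdd_below (g ` {x<..})"
  shows "(g \<longlongrightarrow> Inf (g ` {x<..})) (at_right x)"
proof (rule order_tendstoI)
  fix c assume c: "c < Inf (g ` {x<..})"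
  have "c < g y" if "x < y" for y
    using less_le_trans[OF c cInf_lower[OF _ bdd]] that by blast
  then show "eventually (\<lambda>y. c < g y) (at_right x)"
    by (auto simp: eventually_at_right_field intro: exI[of _ "x + 1"])
next
  fix c assume "Inf (g ` {x<..}) < c"
  then obtain z where z: "x < z" "g z < c"
    using cInf_less_iff[OF _ bdd] by auto
  then have "g y < c" if "x < y" "y < z" for y
    using mono_onD[OF mono, of y z] that by simp
  then show "eventually (\<lambda>y. g y < c) (at_right x)"
    using z by (auto simp: eventually_at_right_field)
qed

lemma mono_on_tendsto_at_left:
  fixes g :: "real \<Rightarrow> real"
  assumes mono: "mono_on {..<x} g" and bdd: "bdd_above (g ` {..<x})"
  shows "(g \<longlongrightarrow> Sup (g ` {..<x})) (at_left x)"
proof (rule order_tendstoI)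
  fix c assume c: "Sup (g ` {..<x}) < c"
  have "g y < c" if "y < x" for y
    using le_less_trans[OF cSup_upper[OF _ bdd] c] that by blast
  then show "eventually (\<lambda>y. g y < c) (at_left x)"
    by (auto simp: eventually_at_left_field intro: exI[of _ "x - 1"])
next
  fix c assume "c < Sup (g ` {..<x})"
  then obtain z where z: "z < x" "c < g z"
    using less_cSup_iff[OF _ bdd] by auto
  then have "c < g y" if "y < x" "z < y" for y
    using mono_onD[OF mono, of z y] that by simp
  then show "eventually (\<lambda>y. c < g y) (at_left x)"
    using z by (auto simp: eventually_at_left_field)
qed

context
  fixes \<phi> :: "real \<Rightarrow> real"
  assumes convex: "convex_on UNIV \<phi>"
begin

text \<open>Serves to match the orientation of the slopes in \<open>convex_on_slope_le\<close> with
  quotients taken at a fixed base point.\<close>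

lemma slope_commute: "(\<phi> p - \<phi> q) / (p - q) = (\<phi> q - \<phi> p) / (q - p)"
  using minus_divide_divide[of "\<phi> p - \<phi> q" "p - q"] by simp

text \<open>The slope of the chord from \<open>u\<close> to \<open>v\<close> lies between the two;
  if \<open>u = v\<close>, the three-point inequality suffices.\<close>

lemma convex_slope_mono:
  assumes "s < u" "u \<le> v" "v < t"
  shows "(\<phi> s - \<phi> u) / (s - u) \<le> (\<phi> t - \<phi> v) / (t - v)"
proof -
  have *: "(\<phi> p - \<phi> q) / (p - q) \<le> (\<phi> r - \<phi> q) / (r - q)" if "p < q" "q < r" for p q r
    using convex_on_slope_le[OF convex _ _ that] slope_commute[of q r] by simp
  show ?thesis
  proof (cases "u = v")
    case True
    then show ?thesis using *[of s u t] assms by simp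
  next
    case False
    then have "(\<phi> s - \<phi> u) / (s - u) \<le> (\<phi> u - \<phi> v) / (u - v)"
      using *[of s u v] slope_commute[of u v] assms by simp
    also have "\<dots> \<le> (\<phi> t - \<phi> v) / (t - v)"
      using *[of u v t] assms False by simp
    finally show ?thesis .
  qed
qed

lemma convex_right_slope_mono:
  "mono_on {x<..} (\<lambda>y. (\<phi> y - \<phi> x) / (y - x))"
proof (rule mono_onI)
  fix y z assume "y \<in> {x<..}" "z \<in> {x<..}" "y \<le> z"
  then show "(\<phi> y - \<phi> x) / (y - x) \<le> (\<phi> z - \<phi> x) / (z - x)"
    using convex_on_slope_le(1)[OF convex, of x z y] slope_commute[of x y] slope_commute[of x z]
    by (cases "y = z") auto
qed

lemma convex_left_slope_mono:
  "mono_on {..<x} (\<lambda>y. (\<phi> y - \<phi> x) / (y - x))"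
proof (rule mono_onI)
  fix y z assume "y \<in> {..<x}" "z \<in> {..<x}" "y \<le> z"
  then show "(\<phi> y - \<phi> x) / (y - x) \<le> (\<phi> z - \<phi> x) / (z - x)"
    using convex_on_slope_le(2)[OF convex, of y x z]
    by (cases "y = z") auto
qed

text \<open>\<open>Lim\<close> is only a choice of limit, so existence has to be shown: the
  quotients are monotone and bounded on the side where they decrease towards
  \<open>x\<close>.\<close>

lemma tendsto_right_deriv:
  "((\<lambda>y. (\<phi> y - \<phi> x) / (y - x)) \<longlongrightarrow> right_deriv \<phi> x) (at_right x)"
proof -
  have "bdd_below ((\<lambda>y. (\<phi> y - \<phi> x) / (y - x)) ` {x<..})"
    \<comment> \<open>The lower bound is the slope of the chord over \<open>[x - 1, x]\<close>; any
      chord ending at \<open>x\<close> from the left would do.\<close>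
    using convex_slope_mono[of "x - 1" x x] by (intro bdd_belowI2) auto
  then show ?thesis
    using mono_on_tendsto_at_right[OF convex_right_slope_mono]
      tendsto_Lim[OF trivial_limit_at_right_real]
    unfolding right_deriv_def by fastforce
qed

lemma tendsto_left_deriv:
  "((\<lambda>y. (\<phi> y - \<phi> x) / (y - x)) \<longlongrightarrow> left_deriv \<phi> x) (at_left x)"
proof -
  have "bdd_above ((\<lambda>y. (\<phi> y - \<phi> x) / (y - x)) ` {..<x})"
    using convex_slope_mono[of _ x x "x + 1"] by (intro bdd_aboveI2) auto
  then show ?thesis
    using mono_on_tendsto_at_left[OF convex_left_slope_mono]
      tendsto_Lim[OF trivial_limit_at_left_real]
    unfolding left_deriv_def by fastforce
qed

end

text \<open>Two successive passages to the limit: first \<open>s\<close> increases to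
  \<open>x\<close> with \<open>t\<close> fixed, then \<open>t\<close> decreases to \<open>y\<close>.
  Functions and base points may differ because two different coordinates are to be compared.\<close>

lemma left_deriv_le_right_deriv:
  assumes "convex_on UNIV \<phi>" "convex_on UNIV \<psi>"
    and "\<And>s t. s < x \<Longrightarrow> y < t \<Longrightarrow> (\<phi> s - \<phi> x) / (s - x) \<le> (\<psi> t - \<psi> y) / (t - y)"
  shows "left_deriv \<phi> x \<le> right_deriv \<psi> y"
proof (rule tendsto_lowerbound[OF tendsto_right_deriv[OF assms(2)]])
  have "left_deriv \<phi> x \<le> (\<psi> t - \<psi> y) / (t - y)" if "y < t" for t
    using assms(3)[OF _ that]
    by (intro tendsto_upperbound[OF tendsto_left_deriv[OF assms(1)]])
      (auto simp: eventually_at_left_field intro: exI[of _ "x - 1"])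
  then show "\<forall>\<^sub>F t in at_right y. left_deriv \<phi> x \<le> (\<psi> t - \<psi> y) / (t - y)"
    by (auto simp: eventually_at_right_field intro: exI[of _ "y + 1"])
qed simp

lemma one_sided_deriv_eq_deriv:
  assumes "(\<phi> has_real_derivative D) (at x)"
  shows "left_deriv \<phi> x = D" "right_deriv \<phi> x = D"
proof -
  have "((\<lambda>y. (\<phi> y - \<phi> x) / (y - x)) \<longlongrightarrow> D) (at x)"
    using assms by (simp add: has_field_derivative_iff)
  then show "left_deriv \<phi> x = D" "right_deriv \<phi> x = D"
    unfolding left_deriv_def right_deriv_def
    by (auto intro!: tendsto_Lim simp: filterlim_at_split)
qed

lemma convex_on_perspective:
  fixes f :: "real \<Rightarrow> real"
  assumes f: "convex_on UNIV f" and "a > 0"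
  shows "convex_on UNIV (\<lambda>t. a * f (t / a + b))"
proof (rule convex_on_cmul)
  show "convex_on UNIV (\<lambda>t. f (t / a + b))"
  proof (rule convex_onI)
    fix t x y :: real assume "0 < t" "t < 1"
    moreover have "((1 - t) *\<^sub>R x + t *\<^sub>R y) / a + b = (1 - t) *\<^sub>R (x / a + b) + t *\<^sub>R (y / a + b)"
      by (simp add: algebra_simps add_divide_distrib diff_divide_distrib)
    ultimately show "f (((1 - t) *\<^sub>R x + t *\<^sub>R y) / a + b) \<le> (1 - t) * f (x / a + b) + t * f (y / a + b)"
      using convex_onD[OF f, of t "x / a + b" "y / a + b"] by simp
  qed simp
qed (use assms in simp)

text \<open>The factor \<open>a\<close> compensates the scaling of increments by
  \<open>1 / a\<close>. For \<open>s = x\<close> both sides are \<open>0\<close>, by division by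
  zero.\<close>

lemma perspective_slope:
  fixes f :: "real \<Rightarrow> real"
  assumes "a > 0"
  shows "(a * f (s / a + b) - a * f (x / a + b)) / (s - x)
    = (f (s / a + b) - f (x / a + b)) / ((s / a + b) - (x / a + b))"
  using assms by (cases "s = x") (simp_all add: field_simps)

theorem theorem1:
  fixes C :: "(real ^ 'n) set"
    and f :: "real \<Rightarrow> real"
    and a b x :: "real ^ 'n"
  assumes "C \<noteq> {}"
    and "convex_on UNIV f"
    and "\<forall>i. a $ i > 0"
    and "\<forall>\<phi> :: 'n \<Rightarrow> real \<Rightarrow> real. (\<forall>i. convex_on UNIV (\<phi> i)) \<longrightarrow>
           (\<forall>y\<in>C. is_arg_min (\<lambda>z. \<Sum>i\<in>UNIV. \<phi> i (z $ i)) (\<lambda>z. z \<in> C) y \<longleftrightarrow>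
              (\<forall>(i, k)\<in>exchangeable_pairs C y.
                 right_deriv (\<phi> k) (y $ k) \<ge> left_deriv (\<phi> i) (y $ i)))"
    and "x \<in> C"
    and "is_arg_min (\<lambda>z. \<Sum>i\<in>UNIV. a $ i * ((1 / 2) * (z $ i / a $ i + b $ i)\<^sup>2)) (\<lambda>z. z \<in> C) x"
  shows "is_arg_min (\<lambda>z. \<Sum>i\<in>UNIV. a $ i * f (z $ i / a $ i + b $ i)) (\<lambda>z. z \<in> C) x"
proof -
  define u where "u i = x $ i / a $ i + b $ i" for i
  define \<psi> where "\<psi> g i t = a $ i * g (t / a $ i + b $ i)" for g :: "real \<Rightarrow> real" and i t
  let ?q = "\<lambda>t::real. (1 / 2) * t\<^sup>2"
  have a: "a $ i > 0" for i
    using assms(3) by blast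
  have convex: "convex_on UNIV (\<psi> g i)" if "convex_on UNIV g" for g i
    unfolding \<psi>_def using convex_on_perspective[OF that a] .
  \<comment> \<open>The assumption on \<open>C\<close>, specialised to the family
    \<open>\<psi> g\<close>. It is read from left to right for \<open>g = ?q\<close> and from right
    to left for \<open>g = f\<close>.\<close>
  have exchange: "is_arg_min (\<lambda>z. \<Sum>i\<in>UNIV. \<psi> g i (z $ i)) (\<lambda>z. z \<in> C) x \<longleftrightarrow>
      (\<forall>(i, k)\<in>exchangeable_pairs C x. left_deriv (\<psi> g i) (x $ i) \<le> right_deriv (\<psi> g k) (x $ k))"
    if "convex_on UNIV g" for g
    using assms(4,5) convex[OF that] by blast
  have "convex_on UNIV ?q"
    by (intro convex_on_cmul convex_power2) simp
  \<comment> \<open>The weight \<open>a $ i\<close> cancels against the inner derivative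
    \<open>1 / a $ i\<close>, and the factor \<open>1 / 2\<close> against the exponent.\<close>
  moreover have "(\<psi> ?q i has_real_derivative u i) (at (x $ i))" for i
    unfolding \<psi>_def u_def using a[of i]
    by (auto intro!: derivative_eq_intros simp: field_simps power2_eq_square power4_eq_xxxx)
  then have "left_deriv (\<psi> ?q i) (x $ i) = u i" "right_deriv (\<psi> ?q i) (x $ i) = u i" for i
    by (rule one_sided_deriv_eq_deriv)+
  ultimately have u: "u i \<le> u k" if "(i, k) \<in> exchangeable_pairs C x" for i k
    using exchange[of ?q] assms(6) that unfolding \<psi>_def by fastforce
  have "left_deriv (\<psi> f i) (x $ i) \<le> right_deriv (\<psi> f k) (x $ k)"
    if "(i, k) \<in> exchangeable_pairs C x" for i k
  proof (rule left_deriv_le_right_deriv)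
    fix s t assume "s < x $ i" "x $ k < t"
    then have "s / a $ i + b $ i < u i" "u k < t / a $ k + b $ k"
      unfolding u_def using a by (simp_all add: divide_strict_right_mono)
    \<comment> \<open>As \<open>u i \<le> u k\<close>, the chord of \<open>f\<close> ending at
      \<open>u i\<close> lies to the left of the one starting at \<open>u k\<close>, so its slope is
      no larger.\<close>
    from convex_slope_mono[OF assms(2) this(1) u[OF that] this(2)]
    show "(\<psi> f i s - \<psi> f i (x $ i)) / (s - x $ i) \<le> (\<psi> f k t - \<psi> f k (x $ k)) / (t - x $ k)"
      unfolding \<psi>_def u_def
      by (simp only: perspective_slope[OF a])
  qed (use convex assms(2) in auto)
  then show ?thesis
    using exchange[OF assms(2)] unfolding \<psi>_def by blast
qed

end
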